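(* Let $V=\bigotimes_{i=1}^d V^{(i)}$ be the Hilbert tensor product of real Hilbert spaces $V^{(1)},\dots,V^{(d)}$, with norm $\|\cdot\|_V$. Let $a:V\times V\to\mathbb R$ be a bilinear form for which there are constants $c_0,c_1>0$ with $|a(u,v)|\le c_1\|u\|_V\|v\|_V$ for all $u,v\in V$ and $a(v,v)\ge c_0\|v\|_V^2$ for all $v\in V$, and let $\ell\in V^*$ be a bounded linear functional. Fix $r\in\mathbb N$ and fixed subatoms $\psi_i^{(j)}\in V^{(i)}$ ($1\le i\le d$, $1\le j\le r$), and let $\mathcal F_r\subset V$ be the associated rank-$r$ CP trial space. Let $u\in V$ be the exact solution, i.e. $a(u,v)=\ell(v)$ for all $v\in V$, and let $u_r\in\mathcal F_r$ be the Galerkin solution, i.e. $a(u_r,v_r)=\ell(v_r)$ for all $v_r\in\mathcal F_r$. Then $$\|u-u_r\|_V\le\frac{c_1}{c_0}\min_{v_r\in\mathcal F_r}\|u-v_r\|_V.$$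
   Context: Each $V^{(i)}$ is a Hilbert space of functions of the $i$-th coordinate (the coordinates range over space, time and parameters), and the elementary tensor $\psi_1\otimes\cdots\otimes\psi_d$ is identified with the product function $x\mapsto\prod_{i=1}^d\psi_i(x_i)$. For fixed subatoms $\psi_i^{(j)}$, the rank-$r$ canonical polyadic (CP) trial space is the finite-dimensional linear subspace $$\mathcal F_r=\left\{\sum_{j=1}^r c^{(j)}\,\psi_1^{(j)}\otimes\cdots\otimes\psi_d^{(j)}\;:\;c^{(j)}\in\mathbb R\right\}\subset V.$$ *)

theory Defs
  imports "HOL-Analysis.Analysis"
begin

text \<open>
  The factors of a tensor product are Hilbert spaces that differ both in their elements and in
  their inner products, so they cannot all be one type of class \<open>real_inner\<close>. A factor is a linear
  subspace \<open>S\<close> of a vector space type carrying its own inner product \<open>ip\<close>, of which only the values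
  on \<open>S\<close> matter. Any finite family of real Hilbert spaces has this form, with the direct sum of the
  underlying vector spaces as ambient type.
\<close>

definition inner_product_on :: "'e::real_vector set \<Rightarrow> ('e \<Rightarrow> 'e \<Rightarrow> real) \<Rightarrow> bool" where
  "inner_product_on S ip \<longleftrightarrow>
     subspace S \<and>
     (\<forall>x\<in>S. \<forall>y\<in>S. ip x y = ip y x) \<and>
     (\<forall>x\<in>S. \<forall>y\<in>S. \<forall>z\<in>S. ip (x + y) z = ip x z + ip y z) \<and>
     (\<forall>c. \<forall>x\<in>S. \<forall>y\<in>S. ip (c *\<^sub>R x) y = c * ip x y) \<and>
     (\<forall>x\<in>S. 0 \<le> ip x x) \<and>
     (\<forall>x\<in>S. ip x x = 0 \<longrightarrow> x = 0)"

definition norm_of :: "('e \<Rightarrow> 'e \<Rightarrow> real) \<Rightarrow> 'e \<Rightarrow> real" where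
  "norm_of ip x = sqrt (ip x x)"

definition hilbert_space_on :: "'e::real_vector set \<Rightarrow> ('e \<Rightarrow> 'e \<Rightarrow> real) \<Rightarrow> bool" where
  "hilbert_space_on S ip \<longleftrightarrow>
     inner_product_on S ip \<and>
     (\<forall>X :: nat \<Rightarrow> 'e.
        range X \<subseteq> S \<and> (\<forall>e>0. \<exists>N. \<forall>m\<ge>N. \<forall>n\<ge>N. norm_of ip (X m - X n) < e) \<longrightarrow>
        (\<exists>l\<in>S. (\<lambda>n. norm_of ip (X n - l)) \<longlonglongrightarrow> 0))"

text \<open>
  The Hilbert tensor product is the completion of the algebraic tensor product for the inner product
  that is multiplicative on elementary tensors. The predicate says that the Hilbert space
  \<open>'v\<close>, with \<open>tensor x\<close> as the elementary tensor of \<open>x 1, \<dots>, x d\<close>, is such a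
  completion: the map induced by \<open>tensor\<close> on the algebraic tensor product is linear, isometric, and
  of dense range. This determines \<open>'v\<close> and \<open>tensor\<close> up to a unique isometric isomorphism. Values of
  \<open>x\<close> outside \<open>{1..d}\<close> are irrelevant: by the second clause,
  two families that agree on \<open>{1..d}\<close> have the same tensor.
\<close>

definition hilbert_tensor_product ::
  "nat \<Rightarrow> (nat \<Rightarrow> 'e::real_vector set) \<Rightarrow> (nat \<Rightarrow> 'e \<Rightarrow> 'e \<Rightarrow> real) \<Rightarrow>
   ((nat \<Rightarrow> 'e) \<Rightarrow> 'v::{real_inner, complete_space}) \<Rightarrow> bool" where
  "hilbert_tensor_product d H ip tensor \<longleftrightarrow>
     (\<forall>x \<in> Pi {1..d} H. \<forall>i\<in>{1..d}. \<forall>y\<in>H i. \<forall>z\<in>H i. \<forall>s t.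
        tensor (x(i := s *\<^sub>R y + t *\<^sub>R z)) =
          s *\<^sub>R tensor (x(i := y)) + t *\<^sub>R tensor (x(i := z))) \<and>
     (\<forall>x \<in> Pi {1..d} H. \<forall>y \<in> Pi {1..d} H.
        inner (tensor x) (tensor y) = (\<Prod>i=1..d. ip i (x i) (y i))) \<and>
     closure (span (tensor ` Pi {1..d} H)) = UNIV"

definition cp_space ::
  "((nat \<Rightarrow> 'e) \<Rightarrow> 'v::real_vector) \<Rightarrow> (nat \<Rightarrow> nat \<Rightarrow> 'e) \<Rightarrow> nat \<Rightarrow> 'v set" where
  "cp_space tensor \<psi> r = {\<Sum>j=1..r. c j *\<^sub>R tensor (\<lambda>i. \<psi> i j) | c :: nat \<Rightarrow> real. True}"

end

theory Submission
  imports Defs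
begin

text \<open>
  Galerkin orthogonality \<open>a (u - ur) v = 0\<close> on the trial space gives
  \<open>c0 * (norm (u - ur))\<^sup>2 \<le> a (u - ur) (u - ur) = a (u - ur) (u - v)\<close> for every \<open>v\<close> in it, and
  continuity bounds the right-hand side. The minimum is attained because the trial space is spanned
  by finitely many vectors, so that \<open>u\<close> has an orthogonal projection onto it.
\<close>

text \<open>Makes the theory of subspaces and finite spans available for the trial space. The
  tensors for different \<open>j\<close> may coincide, so the inclusion of the span is obtained from
  its minimality among subspaces rather than by matching coefficients over the image set.\<close>

lemma cp_space_eq_span:
  "cp_space tensor \<psi> r = span ((\<lambda>j. tensor (\<lambda>i. \<psi> i j)) ` {1..r})"
proof
  show "cp_space tensor \<psi> r \<subseteq> span ((\<lambda>j. tensor (\<lambda>i. \<psi> i j)) ` {1..r})"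
    unfolding cp_space_def by (auto intro!: span_sum span_scale intro: span_base)
  have "subspace (cp_space tensor \<psi> r)"
    unfolding subspace_def
  proof (intro conjI ballI allI)
    show "0 \<in> cp_space tensor \<psi> r"
      unfolding cp_space_def by (auto intro!: exI[of _ "\<lambda>_. 0"])
  next
    fix x y assume "x \<in> cp_space tensor \<psi> r" "y \<in> cp_space tensor \<psi> r"
    then obtain c e where "x = (\<Sum>j=1..r. c j *\<^sub>R tensor (\<lambda>i. \<psi> i j))"
      "y = (\<Sum>j=1..r. e j *\<^sub>R tensor (\<lambda>i. \<psi> i j))"
      unfolding cp_space_def by auto
    then have "x + y = (\<Sum>j=1..r. (c j + e j) *\<^sub>R tensor (\<lambda>i. \<psi> i j))"
      by (simp add: scaleR_add_left sum.distrib)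
    then show "x + y \<in> cp_space tensor \<psi> r"
      unfolding cp_space_def by (intro CollectI exI[of _ "\<lambda>j. c j + e j"]) simp
  next
    fix x and k :: real assume "x \<in> cp_space tensor \<psi> r"
    then obtain c where "x = (\<Sum>j=1..r. c j *\<^sub>R tensor (\<lambda>i. \<psi> i j))"
      unfolding cp_space_def by auto
    then have "k *\<^sub>R x = (\<Sum>j=1..r. (k * c j) *\<^sub>R tensor (\<lambda>i. \<psi> i j))"
      by (simp add: scaleR_sum_right)
    then show "k *\<^sub>R x \<in> cp_space tensor \<psi> r"
      unfolding cp_space_def by (intro CollectI exI[of _ "\<lambda>j. k * c j"]) simp
  qed
  moreover have "tensor (\<lambda>i. \<psi> i j) \<in> cp_space tensor \<psi> r" if "j \<in> {1..r}" for j
  proof -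
    have "tensor (\<lambda>i. \<psi> i j) =
        (\<Sum>k=1..r. (if k = j then 1 else 0) *\<^sub>R tensor (\<lambda>i. \<psi> i k))"
      using that by (simp add: if_distrib[of "\<lambda>c. c *\<^sub>R _"] cong: if_cong)
    then show ?thesis
      unfolding cp_space_def mem_Collect_eq by (intro exI[of _ "\<lambda>k. if k = j then 1 else 0"]) simp
  qed
  ultimately show "span ((\<lambda>j. tensor (\<lambda>i. \<psi> i j)) ` {1..r}) \<subseteq> cp_space tensor \<psi> r"
    by (intro span_minimal) auto
qed

text \<open>The minimiser is the orthogonal projection of \<open>u\<close>, written explicitly in an
  orthogonal generating set; Pythagoras then shows that no other point of the span is
  closer.\<close>

lemma nearest_point_in_finite_span:
  fixes u :: "'v::real_inner"
  assumes "finite B"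
  shows "\<exists>w. is_arg_min (\<lambda>v. norm (u - v)) (\<lambda>v. v \<in> span B) w"
proof -
  obtain C where C: "finite C" "span C = span B" "pairwise orthogonal C"
    using basis_orthogonal[OF assms] by blast
  \<comment> \<open>Fourier coefficients of \<open>u\<close> along \<open>C\<close>. Should
    \<open>0\<close> lie in \<open>C\<close>, its coefficient is \<open>0 / 0 = 0\<close> and its
    term vanishes.\<close>
  define w where "w = (\<Sum>b\<in>C. (b \<bullet> u / (b \<bullet> b)) *\<^sub>R b)"
  have w: "w \<in> span B"
    unfolding w_def C(2)[symmetric] by (intro span_sum span_scale span_base)
  have orth: "orthogonal (u - w) v" if "v \<in> span B" for v
  proof (rule orthogonal_to_span)
    show "v \<in> span C"
      using that C(2) by simp
  next
    fix y assume y: "y \<in> C"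
    have "w \<bullet> y = (\<Sum>b\<in>C. if b = y then u \<bullet> y else 0)"
      unfolding w_def inner_sum_left
    proof (rule sum.cong)
      fix b assume "b \<in> C"
      then show "((b \<bullet> u / (b \<bullet> b)) *\<^sub>R b) \<bullet> y = (if b = y then u \<bullet> y else 0)"
        using pairwiseD[OF C(3) _ y, of b] by (auto simp: orthogonal_def inner_commute)
    qed simp
    then show "orthogonal (u - w) y"
      using C(1) y by (simp add: orthogonal_def inner_diff_left)
  qed
  have "norm (u - w) \<le> norm (u - v)" if v: "v \<in> span B" for v
  proof -
    have "orthogonal (u - w) (w - v)"
      using orth span_diff[OF w v] .
    then have "(norm (u - v))\<^sup>2 = (norm (u - w))\<^sup>2 + (norm (w - v))\<^sup>2"
      using norm_add_Pythagorean[of "u - w" "w - v"] by simp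
    then show ?thesis
      by (simp add: power2_le_imp_le)
  qed
  with w show ?thesis
    by (auto simp: is_arg_min_linorder)
qed

text \<open>Cea's lemma for an arbitrary subspace \<open>S\<close> and any competitor
  \<open>w\<close> in it. \<open>orth\<close> is Galerkin orthogonality, with the functional
  eliminated from the two variational equations.\<close>

lemma Galerkin_quasi_optimal:
  fixes a :: "'v::real_normed_vector \<Rightarrow> 'v \<Rightarrow> real"
  assumes bil: "bilinear a" and "c0 > 0"
    and cont: "\<And>v w. \<bar>a v w\<bar> \<le> c1 * norm v * norm w"
    and coer: "\<And>v. a v v \<ge> c0 * (norm v)\<^sup>2"
    and "subspace S" "ur \<in> S" "w \<in> S"
    and orth: "\<And>v. v \<in> S \<Longrightarrow> a u v = a ur v"
  shows "norm (u - ur) \<le> c1 / c0 * norm (u - w)"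
proof (cases "u = ur")
  case True
  \<comment> \<open>The error is zero here, so the bound only has to be nonnegative: by
    \<open>cont\<close>, either \<open>c1\<close> is nonnegative or \<open>norm (u - w)\<close> is
    zero.\<close>
  have "0 \<le> c1 * norm (u - w) * norm (u - w)"
    using cont[of "u - w" "u - w"] by linarith
  then show ?thesis
    using True \<open>c0 > 0\<close> by (auto simp: zero_le_mult_iff zero_le_divide_iff)
next
  case False
  \<comment> \<open>The test vector \<open>w - ur\<close> lies in \<open>S\<close> and is the
    difference between \<open>u - ur\<close> and \<open>u - w\<close>, so either of these may stand
    in the second argument.\<close>
  have "a (u - ur) (w - ur) = 0"
    using orth[of "w - ur"] assms(5-7) by (simp add: bilinear_lsub[OF bil] subspace_diff)
  then have "a (u - ur) (u - ur) = a (u - ur) (u - w)"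
    by (simp add: bilinear_rsub[OF bil])
  then have "c0 * (norm (u - ur))\<^sup>2 \<le> c1 * norm (u - ur) * norm (u - w)"
    using coer[of "u - ur"] cont[of "u - ur" "u - w"] by linarith
  then have "norm (u - ur) * (c0 * norm (u - ur)) \<le> norm (u - ur) * (c1 * norm (u - w))"
    by (simp add: power2_eq_square mult_ac)
  then have "c0 * norm (u - ur) \<le> c1 * norm (u - w)"
    \<comment> \<open>The common factor \<open>norm (u - ur)\<close> is positive in this case and
      cancels.\<close>
    using False by simp
  then show ?thesis
    using \<open>c0 > 0\<close> by (simp add: field_simps)
qed

theorem theorem3:
  fixes d r :: nat
    and H :: "nat \<Rightarrow> 'e::real_vector set"
    and ip :: "nat \<Rightarrow> 'e \<Rightarrow> 'e \<Rightarrow> real"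
    and tensor :: "(nat \<Rightarrow> 'e) \<Rightarrow> 'v::{real_inner, complete_space}"
    and a :: "'v \<Rightarrow> 'v \<Rightarrow> real"
    and l :: "'v \<Rightarrow> real"
    and c0 c1 :: real
    and \<psi> :: "nat \<Rightarrow> nat \<Rightarrow> 'e"
    and u ur :: 'v
  assumes "\<And>i. i \<in> {1..d} \<Longrightarrow> hilbert_space_on (H i) (ip i)"
    and "hilbert_tensor_product d H ip tensor"
    and "c0 > 0" and "c1 > 0"
    and "bilinear a"
    and "\<And>v w. \<bar>a v w\<bar> \<le> c1 * norm v * norm w"
    and "\<And>v. a v v \<ge> c0 * (norm v)\<^sup>2"
    and "bounded_linear l"
    and "\<And>i j. i \<in> {1..d} \<Longrightarrow> j \<in> {1..r} \<Longrightarrow> \<psi> i j \<in> H i"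
    and "\<And>v. a u v = l v"
    and "ur \<in> cp_space tensor \<psi> r"
    and "\<And>v. v \<in> cp_space tensor \<psi> r \<Longrightarrow> a ur v = l v"
  shows "\<exists>w. is_arg_min (\<lambda>v. norm (u - v)) (\<lambda>v. v \<in> cp_space tensor \<psi> r) w \<and>
             norm (u - ur) \<le> c1 / c0 * norm (u - w)"
proof -
  let ?S = "cp_space tensor \<psi> r"
  obtain w where w: "is_arg_min (\<lambda>v. norm (u - v)) (\<lambda>v. v \<in> ?S) w"
    unfolding cp_space_eq_span using nearest_point_in_finite_span by blast
  have "norm (u - ur) \<le> c1 / c0 * norm (u - w)"
  proof (rule Galerkin_quasi_optimal[OF assms(5,3,6,7)])
    show "subspace ?S"
      by (simp add: cp_space_eq_span)
    show "w \<in> ?S"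
      using w by (simp add: is_arg_min_def)
  \<comment> \<open>Galerkin orthogonality: on the trial space \<open>a u v\<close> and
    \<open>a ur v\<close> both equal \<open>l v\<close>.\<close>
  qed (use assms(10-12) in auto)
  with w show ?thesis by blast
qed

end
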